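(* Let $1\le k\le d$ be integers, let $\mathcal F=\{f_1,\dots,f_m\}$ be a set of vectors in $\mathbb C^d$ and let $F=[f_1,\dots,f_m]\in\mathbb C^{d\times m}$ be the associated frame matrix. The following properties are equivalent: (A) For any $x_0\in\mathbb C^d_k$, $$\operatorname*{argmin}_{\tilde x\in\mathbb C^d/\sim}\bigl\{\|x\|_1:\ |F^\top x|=|F^\top x_0|\bigr\}=\tilde x_0,$$ i.e. the class $\tilde x_0$ is the unique minimizer (equivalently, the set of minimizers $x\in\mathbb C^d$ of $\|x\|_1$ subject to $|F^\top x|=|F^\top x_0|$ is exactly $\{cx_0: c\in\mathbb S\}$). (B) Whenever $S_1,\dots,S_p$ is a partition of $\{1,\dots,m\}$ and $\eta_j\in\mathcal N(F_{S_j})\setminus\{0\}$ ($j=1,\dots,p$) satisfy $$\frac{\eta_1-\eta_\ell}{c_1-c_\ell}=\frac{\eta_1-\eta_j}{c_1-c_j}\in\mathbb C^d_k\setminus\{0\}\quad\text{for all } \ell,j\in\{2,\dots,p\}$$ for some pairwise distinct $c_1,\dots,c_p\in\mathbb S$, one has $$\|\eta_j-\eta_\ell\|_1<\|c_\ell\eta_j-c_j\eta_\ell\|_1$$ for all $j,\ell\in\{1,\dots,p\}$ with $j\ne\ell$.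
   Context: $\mathbb S=\{c\in\mathbb C:|c|=1\}$. $\|x\|_0$ is the number of nonzero entries of $x$, $\mathbb C^d_k=\{x\in\mathbb C^d:\|x\|_0\le k\}$, and $\|x\|_1=\sum_i|x_i|$. On $\mathbb C^d$, $x\sim y$ iff $x=cy$ for some $c\in\mathbb S$; $\tilde x$ denotes the class of $x$ (both $\|x\|_1$ and $|F^\top x|$ depend only on $\tilde x$). The convention is $\langle f_j,x\rangle=f_j^\top x$, so $|F^\top x|=[|\langle f_1,x\rangle|,\dots,|\langle f_m,x\rangle|]^\top$ is the entrywise modulus of $F^\top x$. For $S\subseteq\{1,\dots,m\}$, $F_S$ is the matrix whose columns are the $f_j$, $j\in S$, and $\mathcal N(F_S)=\{\eta\in\mathbb C^d:\langle f_j,\eta\rangle=0\text{ for all } j\in S\}$ (the kernel of $F_S^\top$), with $\mathcal N(F_\emptyset)=\mathbb C^d$. A partition $S_1,\dots,S_p$ of $\{1,\dots,m\}$ ($p$ a positive integer) means subsets $S_j\subseteq\{1,\dots,m\}$ that are pairwise disjoint with union $\{1,\dots,m\}$; members $S_j$ are allowed to be empty. *)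

theory Defs
  imports "HOL-Analysis.Analysis"
begin

definition norm0 :: "complex ^ 'd \<Rightarrow> nat" where
  "norm0 x = card {i. x $ i \<noteq> 0}"

definition sparse_vecs :: "nat \<Rightarrow> (complex ^ 'd) set" where
  "sparse_vecs k = {x. norm0 x \<le> k}"

definition norm1 :: "complex ^ 'd \<Rightarrow> real" where
  "norm1 x = (\<Sum>i\<in>UNIV. cmod (x $ i))"

(* The vectors f j are the columns: d rows, m columns. *)
definition frame_matrix :: "('m::finite \<Rightarrow> complex ^ 'd) \<Rightarrow> complex ^ 'm ^ 'd" where
  "frame_matrix f = (\<chi> i j. f j $ i)"

definition entrywise_abs :: "complex ^ 'm \<Rightarrow> real ^ 'm" where
  "entrywise_abs y = (\<chi> j. cmod (y $ j))"

(* The pairing is bilinear (no complex conjugation), so the transpose is the plain one. *)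
definition magnitudes :: "('m::finite \<Rightarrow> complex ^ 'd) \<Rightarrow> complex ^ 'd \<Rightarrow> real ^ 'm" where
  "magnitudes f x = entrywise_abs (transpose (frame_matrix f) *v x)"

definition pairing :: "complex ^ 'd \<Rightarrow> complex ^ 'd \<Rightarrow> complex" where
  "pairing u x = (\<Sum>i\<in>UNIV. u $ i * x $ i)"

(* The kernel of the transpose of the submatrix with columns f j, j in S;
   the whole space if S is empty. *)
definition null_space :: "('m::finite \<Rightarrow> complex ^ 'd) \<Rightarrow> 'm set \<Rightarrow> (complex ^ 'd) set" where
  "null_space f S = {\<eta>. \<forall>j\<in>S. pairing (f j) \<eta> = 0}"

definition phase_equiv :: "complex ^ 'd \<Rightarrow> complex ^ 'd \<Rightarrow> bool" where
  "phase_equiv x y \<longleftrightarrow> (\<exists>c\<in>sphere 0 1. x = c *s y)"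

lemma equivp_phase_equiv: "equivp (phase_equiv :: complex ^ 'd \<Rightarrow> _)"
proof (rule equivpI)
  show "reflp (phase_equiv :: complex ^ 'd \<Rightarrow> _)"
    by (auto simp: reflp_def phase_equiv_def intro!: bexI[of _ 1])
  show "symp (phase_equiv :: complex ^ 'd \<Rightarrow> _)"
  proof (rule sympI)
    fix x y :: "complex ^ 'd"
    assume "phase_equiv x y"
    then obtain c where c: "cmod c = 1" "x = c *s y"
      by (auto simp: phase_equiv_def)
    then have "c \<noteq> 0" by auto
    with c show "phase_equiv y x"
      by (auto simp: phase_equiv_def norm_inverse intro!: bexI[of _ "inverse c"])
  qed
  show "transp (phase_equiv :: complex ^ 'd \<Rightarrow> _)"
  proof (rule transpI)
    fix x y z :: "complex ^ 'd"
    assume "phase_equiv x y" "phase_equiv y z"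
    then obtain c e where "cmod c = 1" "x = c *s y" "cmod e = 1" "y = e *s z"
      by (auto simp: phase_equiv_def)
    then show "phase_equiv x z"
      by (auto simp: phase_equiv_def norm_mult intro!: bexI[of _ "c * e"])
  qed
qed

quotient_type 'd phase_class = "complex ^ 'd" / phase_equiv
  by (rule equivp_phase_equiv)

lift_definition phase_class_of :: "complex ^ 'd \<Rightarrow> 'd phase_class" is "\<lambda>x. x" .

lift_definition class_norm1 :: "'d::finite phase_class \<Rightarrow> real" is norm1
  by (auto simp: phase_equiv_def norm1_def norm_mult)

lift_definition class_magnitudes ::
  "('m::finite \<Rightarrow> complex ^ 'd) \<Rightarrow> 'd phase_class \<Rightarrow> real ^ 'm" is magnitudes
  by (auto simp: phase_equiv_def magnitudes_def entrywise_abs_def vec_eq_iff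
      matrix_vector_mult_def norm_mult mult.left_commute simp flip: sum_distrib_left)

(* Members may be empty; disjointness is between different indices. *)
definition indexed_partition :: "nat \<Rightarrow> (nat \<Rightarrow> 'm set) \<Rightarrow> bool" where
  "indexed_partition p S \<longleftrightarrow>
     disjoint_family_on S {1..p} \<and> (\<Union>j\<in>{1..p}. S j) = UNIV"

end

theory Submission
  imports Defs
begin

text \<open>
  Two vectors \<open>v\<close>, \<open>w\<close> have the same magnitudes iff every \<open>f\<^sub>i\<close> annihilates \<open>v + c w\<close> for some
  unimodular \<open>c\<close>. Grouping the indices by the value of \<open>c\<close> gives the partition, with
  \<open>\<eta>\<^sub>j = v + c\<^sub>j w\<close>. Conversely the common quotient in (B) is \<open>w\<close>, and \<open>v = \<eta>\<^sub>1 - c\<^sub>1 w\<close>. Since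
  \<open>\<eta>\<^sub>j - \<eta>\<^sub>l = (c\<^sub>j - c\<^sub>l) w\<close> and \<open>c\<^sub>l \<eta>\<^sub>j - c\<^sub>j \<eta>\<^sub>l = (c\<^sub>l - c\<^sub>j) v\<close>, the inequality in (B) says that
  \<open>w\<close> has smaller norm than \<open>v\<close>.
\<close>

lemma norm1_scale: "norm1 (a *s x) = cmod a * norm1 x"
  by (simp add: norm1_def norm_mult sum_distrib_left)

lemma norm1_0 [simp]: "norm1 0 = 0"
  by (simp add: norm1_def)

lemma norm1_pos: "x \<noteq> 0 \<Longrightarrow> 0 < norm1 x"
  by (auto simp: norm1_def vec_eq_iff intro!: sum_pos2)

lemma pairing_add: "pairing u (x + y) = pairing u x + pairing u y"
  by (simp add: pairing_def distrib_left sum.distrib)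

lemma pairing_scale: "pairing u (a *s x) = a * pairing u x"
  by (simp add: pairing_def sum_distrib_left mult.left_commute)

lemma pairing_0 [simp]: "pairing u 0 = 0"
  by (simp add: pairing_def)

text \<open>The entry at \<open>i\<close> of the transposed matrix product is
  \<open>pairing (f i) x\<close>. This puts the constraint in terms of the same numbers that define
  \<open>null_space\<close>.\<close>

lemma magnitudes_eq_iff:
  "magnitudes f x = magnitudes f y \<longleftrightarrow> (\<forall>i. cmod (pairing (f i) x) = cmod (pairing (f i) y))"
  by (simp add: magnitudes_def entrywise_abs_def pairing_def frame_matrix_def transpose_def
      matrix_vector_mult_def vec_eq_iff)

text \<open>For nonzero \<open>b\<close> the phase is forced to be \<open>- a / b\<close>,
  unimodular since the moduli agree. For \<open>b = 0\<close> also \<open>a = 0\<close>, and any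
  phase works.\<close>

lemma cmod_eq_imp_add_phase:
  fixes a b :: complex
  assumes "cmod a = cmod b"
  obtains c where "cmod c = 1" "a + c * b = 0"
proof (cases "b = 0")
  case True
  then show ?thesis using assms that[of 1] by simp
next
  case False
  then show ?thesis using assms that[of "- a / b"] by (simp add: norm_divide)
qed

lemma cmod_eq_if_add_phase:
  fixes a b c :: complex
  assumes "cmod c = 1" "a + c * b = 0"
  shows "cmod a = cmod b"
proof -
  have "a = - (c * b)" using assms(2) by (simp add: eq_neg_iff_add_eq_0)
  then show ?thesis using assms(1) by (simp add: norm_mult)
qed

lemma class_norm1_phase_class_of [simp]: "class_norm1 (phase_class_of x) = norm1 x"
  by transfer simp

lemma class_magnitudes_phase_class_of [simp]:
  "class_magnitudes f (phase_class_of x) = magnitudes f x"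
  by transfer simp

text \<open>Removes the quotient type from the argument: every class has a representative and
  \<open>norm1\<close> is constant on classes, so unique minimality becomes a strict inequality
  against each feasible vector outside the class.\<close>

lemma unique_arg_min_iff:
  fixes f :: "'m::finite \<Rightarrow> complex ^ 'd"
  shows "{u. is_arg_min class_norm1 (\<lambda>u. class_magnitudes f u = magnitudes f x0) u} = {phase_class_of x0}
   \<longleftrightarrow> (\<forall>x. magnitudes f x = magnitudes f x0 \<longrightarrow> phase_equiv x x0 \<or> norm1 x0 < norm1 x)"
  (is "?M = _ \<longleftrightarrow> ?R")
proof -
  have surj: "\<exists>x. u = phase_class_of x" for u :: "'d phase_class"
    by transfer (auto intro: equivp_reflp[OF equivp_phase_equiv])
  have mem: "phase_class_of x \<in> ?M \<longleftrightarrow> magnitudes f x = magnitudes f x0 \<and>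
      (\<forall>y. magnitudes f y = magnitudes f x0 \<longrightarrow> norm1 x \<le> norm1 y)" for x
  proof -
    have "phase_class_of x \<in> ?M \<longleftrightarrow> magnitudes f x = magnitudes f x0 \<and>
      (\<forall>u. class_magnitudes f u = magnitudes f x0 \<longrightarrow> norm1 x \<le> class_norm1 u)"
      by (auto simp: is_arg_min_def not_less)
    also have "\<dots> \<longleftrightarrow> magnitudes f x = magnitudes f x0 \<and>
      (\<forall>y. magnitudes f y = magnitudes f x0 \<longrightarrow> norm1 x \<le> norm1 y)"
      by (metis surj class_norm1_phase_class_of class_magnitudes_phase_class_of)
    finally show ?thesis .
  qed
  have eq: "phase_class_of x = phase_class_of y \<longleftrightarrow> phase_equiv x y" for x y :: "complex ^ 'd"
    by transfer simp
  have norm_eq: "norm1 x = norm1 x0" if "phase_equiv x x0" for x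
    using that by (auto simp: phase_equiv_def norm1_scale)
  have "?M = {phase_class_of x0} \<longleftrightarrow> (\<forall>x. phase_class_of x \<in> ?M \<longleftrightarrow> phase_equiv x x0)"
    by (metis (no_types, lifting) eq surj singletonD singletonI set_eqI)
  also have "\<dots> \<longleftrightarrow> ?R"
  proof
    assume L: "\<forall>x. phase_class_of x \<in> ?M \<longleftrightarrow> phase_equiv x x0"
    then have "phase_class_of x0 \<in> ?M"
      using equivp_reflp[OF equivp_phase_equiv] by blast
    \<comment> \<open>A feasible \<open>x\<close> with \<open>norm1 x\<close> at most
      \<open>norm1 x0\<close> would itself be a minimizer, hence lie in the class of
      \<open>x0\<close>.\<close>
    then show ?R using L mem by (meson le_less_trans not_less order_trans)
  next
    assume R: ?R
    show "\<forall>x. phase_class_of x \<in> ?M \<longleftrightarrow> phase_equiv x x0"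
    proof
      fix x
      have "magnitudes f x = magnitudes f x0" if "phase_equiv x x0"
        using that by (auto simp: phase_equiv_def magnitudes_eq_iff pairing_scale norm_mult)
      \<comment> \<open>A minimizer outside the class would have norm strictly above that of
        \<open>x0\<close>, which is feasible; inside the class feasibility and norm agree with those
        of \<open>x0\<close>.\<close>
      then show "phase_class_of x \<in> ?M \<longleftrightarrow> phase_equiv x x0"
        unfolding mem using R norm_eq by (metis less_imp_le not_less order_refl)
    qed
  qed
  finally show ?thesis .
qed

lemma norm1_diff_less_iff:
  fixes v w :: "complex ^ 'd"
  assumes "a \<noteq> b"
  shows "norm1 ((v + a *s w) - (v + b *s w)) < norm1 (b *s (v + a *s w) - a *s (v + b *s w))
    \<longleftrightarrow> norm1 w < norm1 v"
proof -
  have "(v + a *s w) - (v + b *s w) = (a - b) *s w"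
    by (simp add: vec_eq_iff algebra_simps)
  moreover have "b *s (v + a *s w) - a *s (v + b *s w) = (b - a) *s v"
    by (simp add: vec_eq_iff algebra_simps)
  moreover have "cmod (b - a) = cmod (a - b)" "0 < cmod (a - b)"
    using assms by (simp_all add: norm_minus_commute)
  ultimately show ?thesis by (simp only: norm1_scale mult_less_cancel_left_pos)
qed

theorem theorem3p3:
  fixes f :: "'m::finite \<Rightarrow> complex ^ 'd" and k :: nat
  assumes "1 \<le> k" and "k \<le> CARD('d)"
  shows
    "(\<forall>x0 \<in> sparse_vecs k.
        {u. is_arg_min class_norm1 (\<lambda>u. class_magnitudes f u = magnitudes f x0) u}
          = {phase_class_of x0})
     \<longleftrightarrow>
     (\<forall>(p::nat) (S :: nat \<Rightarrow> 'm set) (\<eta> :: nat \<Rightarrow> complex ^ 'd) (c :: nat \<Rightarrow> complex).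
        1 \<le> p \<longrightarrow>
        indexed_partition p S \<longrightarrow>
        (\<forall>j\<in>{1..p}. \<eta> j \<in> null_space f (S j) - {0}) \<longrightarrow>
        (\<forall>j\<in>{1..p}. c j \<in> sphere 0 1) \<longrightarrow>
        inj_on c {1..p} \<longrightarrow>
        (\<forall>l\<in>{2..p}. \<forall>j\<in>{2..p}.
           inverse (c 1 - c l) *s (\<eta> 1 - \<eta> l) = inverse (c 1 - c j) *s (\<eta> 1 - \<eta> j) \<and>
           inverse (c 1 - c j) *s (\<eta> 1 - \<eta> j) \<in> sparse_vecs k - {0}) \<longrightarrow>
        (\<forall>j\<in>{1..p}. \<forall>l\<in>{1..p}. j \<noteq> l \<longrightarrow>
           norm1 (\<eta> j - \<eta> l) < norm1 (c l *s \<eta> j - c j *s \<eta> l)))"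
  (is "?A \<longleftrightarrow> ?B")
proof
  assume A: ?A
  have min: "phase_equiv x x0 \<or> norm1 x0 < norm1 x"
    if "x0 \<in> sparse_vecs k" "magnitudes f x = magnitudes f x0" for x x0
    using A that by (simp only: unique_arg_min_iff)
  show ?B
  proof (intro allI impI ballI)
    fix p S c j l and \<eta> :: "nat \<Rightarrow> complex ^ 'd"
    assume p: "1 \<le> p" and S: "indexed_partition p S"
      and \<eta>: "\<forall>j\<in>{1..p}. \<eta> j \<in> null_space f (S j) - {0}"
      and c: "\<forall>j\<in>{1..p}. c j \<in> sphere 0 1" and inj: "inj_on c {1..p}"
      and quot: "\<forall>l\<in>{2..p}. \<forall>j\<in>{2..p}.
        inverse (c 1 - c l) *s (\<eta> 1 - \<eta> l) = inverse (c 1 - c j) *s (\<eta> 1 - \<eta> j) \<and>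
        inverse (c 1 - c j) *s (\<eta> 1 - \<eta> j) \<in> sparse_vecs k - {0}"
      and j: "j \<in> {1..p}" and l: "l \<in> {1..p}" and "j \<noteq> l"
    \<comment> \<open>Distinct \<open>j\<close> and \<open>l\<close> force \<open>p\<close> to be at
      least 2, so the common quotient can be read off at index 2.\<close>
    then have two: "2 \<in> {2..p}" by auto
    define w where "w = inverse (c 1 - c 2) *s (\<eta> 1 - \<eta> 2)"
    define v where "v = \<eta> 1 - c 1 *s w"
    have w: "w \<in> sparse_vecs k" "w \<noteq> 0" using bspec[OF bspec[OF quot two] two] by (simp_all add: w_def)
    have \<eta>_eq: "\<eta> i = v + c i *s w" if i: "i \<in> {1..p}" for i
    proof (cases "i = 1")
      case True
      then show ?thesis by (simp add: v_def)
    next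
      case False
      then have "i \<in> {2..p}" using i by auto
      then have wi: "w = inverse (c 1 - c i) *s (\<eta> 1 - \<eta> i)"
        using bspec[OF bspec[OF quot two]] by (simp add: w_def)
      have "c 1 \<noteq> c i" using inj_onD[OF inj, of 1 i] False i p by auto
      then have "(c 1 - c i) *s w = \<eta> 1 - \<eta> i"
        by (simp add: wi vector_smult_assoc)
      then show ?thesis by (simp add: v_def vector_sub_rdistrib algebra_simps)
    qed
    have ann: "\<exists>n\<in>{1..p}. pairing (f i) v + c n * pairing (f i) w = 0" for i
    proof -
      have "i \<in> (\<Union>n\<in>{1..p}. S n)" using S by (simp add: indexed_partition_def)
      then obtain n where n: "n \<in> {1..p}" "i \<in> S n" by blast
      then have "pairing (f i) (\<eta> n) = 0" using \<eta> by (auto simp: null_space_def)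
      then show ?thesis using n(1) \<eta>_eq by (auto simp: pairing_add pairing_scale)
    qed
    have "magnitudes f v = magnitudes f w"
      unfolding magnitudes_eq_iff using ann c by (meson cmod_eq_if_add_phase mem_sphere_0)
    \<comment> \<open>If \<open>v = a *s w\<close>, then \<eta> at \<open>n\<close> is
      \<open>(a + c n) *s w\<close>. As it is nonzero, \<open>a + c n\<close> cannot vanish, so
      \<open>ann\<close> makes every \<open>f i\<close> annihilate \<open>w\<close>.\<close>
    moreover have "\<not> phase_equiv v w"
    proof
      assume "phase_equiv v w"
      then obtain a where v: "v = a *s w" by (auto simp: phase_equiv_def)
      have "pairing (f i) w = 0" for i
      proof -
        obtain n where n: "n \<in> {1..p}" "pairing (f i) v + c n * pairing (f i) w = 0"
          using ann by blast
        have "\<eta> n = (a + c n) *s w" using \<eta>_eq[OF n(1)] by (simp add: v vec_eq_iff distrib_right)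
        moreover have "\<eta> n \<noteq> 0" using \<eta> n(1) by blast
        ultimately have "a + c n \<noteq> 0" by (metis vector_smult_lzero)
        moreover have "(a + c n) * pairing (f i) w = 0"
          using n(2) by (simp add: v pairing_scale distrib_right)
        ultimately show ?thesis by simp
      qed
      \<comment> \<open>Now the zero vector is feasible for \<open>w\<close> and has smaller norm,
        contradicting the minimality of \<open>w\<close>.\<close>
      then have "magnitudes f 0 = magnitudes f w" by (simp add: magnitudes_eq_iff)
      then have "phase_equiv 0 w \<or> norm1 w < norm1 (0 :: complex ^ 'd)" using min w(1) by blast
      then show False using w(2) norm1_pos[OF w(2)] by (auto simp: phase_equiv_def)
    qed
    ultimately have "norm1 w < norm1 v" using min w(1) by blast
    moreover have "c j \<noteq> c l" using inj_onD[OF inj] j l \<open>j \<noteq> l\<close> by blast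
    ultimately show "norm1 (\<eta> j - \<eta> l) < norm1 (c l *s \<eta> j - c j *s \<eta> l)"
      by (simp only: \<eta>_eq[OF j] \<eta>_eq[OF l] norm1_diff_less_iff simp_thms)
  qed
next
  assume B: ?B
  show ?A
    unfolding unique_arg_min_iff
  proof (intro ballI allI impI)
    fix w v
    assume w: "w \<in> sparse_vecs k" and mag: "magnitudes f v = magnitudes f w"
    \<comment> \<open>The case \<open>w = 0\<close> is separate because \<open>?B\<close> requires a
      nonzero common quotient, and that quotient will be \<open>w\<close>.\<close>
    show "phase_equiv v w \<or> norm1 w < norm1 v"
    proof (rule disjCI, cases "w = 0")
      case True
      assume "\<not> norm1 w < norm1 v"
      then have "v = 0" using True norm1_pos by fastforce
      then show "phase_equiv v w" using True equivp_reflp[OF equivp_phase_equiv] by blast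
    next
      case False
      assume not_less: "\<not> norm1 w < norm1 v"
      show "phase_equiv v w"
      proof (rule ccontr)
        assume nequiv: "\<not> phase_equiv v w"
        have "\<forall>i. \<exists>a. cmod a = 1 \<and> pairing (f i) v + a * pairing (f i) w = 0"
          using mag unfolding magnitudes_eq_iff by (meson cmod_eq_imp_add_phase)
        then obtain g where g: "\<And>i. cmod (g i) = 1"
          "\<And>i. pairing (f i) v + g i * pairing (f i) w = 0"
          by metis
        \<comment> \<open>The phases \<open>1\<close> and \<open>-1\<close>, possibly with empty members of the partition, ensure that
          there are at least two members.\<close>
        define C where "C = range g \<union> {1, -1}"
        define p where "p = card C"
        have fin: "finite C" by (simp add: C_def)
        have "card {1, -1 :: complex} \<le> card C"
          by (rule card_mono[OF fin]) (simp add: C_def)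
        then have p: "2 \<le> p" by (simp add: p_def)
        obtain c where c: "bij_betw c {1..p} C"
          using ex_bij_betw_nat_finite_1[OF fin] unfolding p_def by blast
        then have inj: "inj_on c {1..p}" and im: "c ` {1..p} = C"
          by (simp_all only: bij_betw_def)
        \<comment> \<open>These are the fibres of \<open>g\<close>; the fibre over \<open>1\<close>
          or \<open>-1\<close> is empty if \<open>g\<close> does not take that value.\<close>
        define S where "S j = {i. g i = c j}" for j
        define \<eta> where "\<eta> j = v + c j *s w" for j
        have c_norm: "cmod (c j) = 1" if "j \<in> {1..p}" for j
        proof -
          have "c j \<in> C" using im that by blast
          then show ?thesis using g(1) by (auto simp: C_def)
        qed
        have part: "indexed_partition p S"
        proof -
          have "disjoint_family_on S {1..p}"
            using inj_onD[OF inj] by (fastforce simp: disjoint_family_on_def S_def)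
          moreover have "\<exists>j\<in>{1..p}. g i = c j" for i
          proof -
            have "g i \<in> c ` {1..p}" unfolding im C_def by blast
            then show ?thesis by blast
          qed
          ultimately show ?thesis unfolding indexed_partition_def S_def by blast
        qed
        have null: "\<eta> j \<in> null_space f (S j) - {0}" if "j \<in> {1..p}" for j
        proof -
          \<comment> \<open>A vanishing \<open>\<eta> j\<close> would give
            \<open>v = (- c j) *s w\<close>, a phase equivalence.\<close>
          have "- c j \<in> sphere 0 1" using c_norm[OF that] by simp
          then have "v \<noteq> (- c j) *s w" using nequiv phase_equiv_def by blast
          then have "\<eta> j \<noteq> 0" by (simp add: \<eta>_def vec_eq_iff eq_neg_iff_add_eq_0)
          moreover have "pairing (f i) (\<eta> j) = 0" if "i \<in> S j" for i
          proof -
            have "c j = g i" using that by (simp add: S_def)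
            then show ?thesis using g(2)[of i] by (simp add: \<eta>_def pairing_add pairing_scale)
          qed
          ultimately show ?thesis by (simp add: null_space_def)
        qed
        have quot: "inverse (c 1 - c j) *s (\<eta> 1 - \<eta> j) = w" if "j \<in> {2..p}" for j
        proof -
          have nz: "c 1 - c j \<noteq> 0" using inj_onD[OF inj, of 1 j] that by auto
          have "\<eta> 1 - \<eta> j = (c 1 - c j) *s w"
            by (simp add: \<eta>_def vector_sub_rdistrib)
          then show ?thesis by (simp only: vector_smult_assoc left_inverse[OF nz] vector_smult_lid)
        qed
        \<comment> \<open>A single pair of indices suffices, since the inequality for any pair
          amounts to \<open>norm1 w < norm1 v\<close>.\<close>
        have "norm1 (\<eta> 1 - \<eta> 2) < norm1 (c 2 *s \<eta> 1 - c 1 *s \<eta> 2)"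
        proof (rule B[rule_format, of p S \<eta> c 1 2])
          show "indexed_partition p S" "inj_on c {1..p}" by fact+
          show "\<eta> j \<in> null_space f (S j) - {0}" if "j \<in> {1..p}" for j
            using null that by blast
          show "c j \<in> sphere 0 1" if "j \<in> {1..p}" for j
            using c_norm that by simp
          show "inverse (c 1 - c l) *s (\<eta> 1 - \<eta> l) = inverse (c 1 - c j) *s (\<eta> 1 - \<eta> j) \<and>
              inverse (c 1 - c j) *s (\<eta> 1 - \<eta> j) \<in> sparse_vecs k - {0}"
            if "l \<in> {2..p}" "j \<in> {2..p}" for l j
            using quot that w False by simp
        qed (use p in auto)
        moreover have "c 1 \<noteq> c 2" using inj_onD[OF inj, of 1 2] p by auto
        ultimately show False using not_less by (simp only: \<eta>_def norm1_diff_less_iff simp_thms)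
      qed
    qed
  qed
qed

end
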